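(* Let $a,b,p,q\in\mathbb{Z}$ with $p^2+4q\neq 0$, let $(w_n)_{n\ge 0}$ be the Horadam sequence $w_0=a$, $w_1=b$, $w_n=p\,w_{n-1}+q\,w_{n-2}$ for $n\ge 2$, and let $BH_n=w_n+w_{n+1}i+w_{n+2}j+w_{n+3}k\in\mathbb{BC}$ be the $n$th bicomplex Horadam number. Let $\alpha=\frac{p+\sqrt{p^2+4q}}{2}$ and $\beta=\frac{p-\sqrt{p^2+4q}}{2}$ be the roots of $t^2-pt-q=0$, and set $A=b-a\beta$, $B=b-a\alpha$, $\underline{\alpha}=1+\alpha i+\alpha^2 j+\alpha^3 k$, $\underline{\beta}=1+\beta i+\beta^2 j+\beta^3 k$. Then for all integers $n\ge r\ge 0$, $$BH_n^2-BH_{n+r}BH_{n-r}=\frac{AB\,\underline{\alpha}\,\underline{\beta}\,(-q)^{n-r}}{p^2+4q}\,(\alpha^r-\beta^r)^2.$$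
   Context: $\mathbb{BC}=\{z_1+z_2 j : z_1,z_2\in\mathbb{C}\}$ is the algebra of bicomplex numbers: the commutative associative real algebra with basis $1,i,j,k$, where $i^2=j^2=-1$, $ij=ji=k$, $k^2=1$, $ik=ki=-j$, $jk=kj=-i$. Here $\mathbb{C}=\{x+yi : x,y\in\mathbb{R}\}\subset\mathbb{BC}$; if $p^2+4q<0$ the roots $\alpha,\beta$ are regarded as elements of this copy of $\mathbb{C}$ (with a fixed choice of the square root). Convention: $0^0=1$. *)

theory Defs
  imports Complex_Main
begin

text \<open>\<open>Bicomplex z1 z2\<close> stands for \<open>z1 + z2 j\<close>.\<close>

datatype bicomplex = Bicomplex (bc_fst: complex) (bc_snd: complex)

instantiation bicomplex :: comm_ring_1
begin

definition zero_bicomplex :: bicomplex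
  where "0 = Bicomplex 0 0"

definition one_bicomplex :: bicomplex
  where "1 = Bicomplex 1 0"

definition plus_bicomplex :: "bicomplex \<Rightarrow> bicomplex \<Rightarrow> bicomplex"
  where "x + y = Bicomplex (bc_fst x + bc_fst y) (bc_snd x + bc_snd y)"

definition uminus_bicomplex :: "bicomplex \<Rightarrow> bicomplex"
  where "- x = Bicomplex (- bc_fst x) (- bc_snd x)"

definition minus_bicomplex :: "bicomplex \<Rightarrow> bicomplex \<Rightarrow> bicomplex"
  where "x - y = Bicomplex (bc_fst x - bc_fst y) (bc_snd x - bc_snd y)"

definition times_bicomplex :: "bicomplex \<Rightarrow> bicomplex \<Rightarrow> bicomplex"
  where "x * y = Bicomplex (bc_fst x * bc_fst y - bc_snd x * bc_snd y)
                           (bc_fst x * bc_snd y + bc_snd x * bc_fst y)"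

instance
  by standard
    (simp_all add: zero_bicomplex_def one_bicomplex_def plus_bicomplex_def
      uminus_bicomplex_def minus_bicomplex_def times_bicomplex_def algebra_simps)

end

instantiation bicomplex :: real_algebra_1
begin

definition scaleR_bicomplex :: "real \<Rightarrow> bicomplex \<Rightarrow> bicomplex"
  where "scaleR c x = Bicomplex (scaleR c (bc_fst x)) (scaleR c (bc_snd x))"

instance
  by standard
    (simp_all add: scaleR_bicomplex_def plus_bicomplex_def times_bicomplex_def algebra_simps)

end

definition of_complex :: "complex \<Rightarrow> bicomplex"
  where "of_complex z = Bicomplex z 0"

definition bc_i :: bicomplex where "bc_i = Bicomplex \<i> 0"
definition bc_j :: bicomplex where "bc_j = Bicomplex 0 1"
definition bc_k :: bicomplex where "bc_k = Bicomplex 0 \<i>"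

lemmas bicomplex_defs =
  zero_bicomplex_def one_bicomplex_def plus_bicomplex_def uminus_bicomplex_def
  minus_bicomplex_def times_bicomplex_def scaleR_bicomplex_def
  of_complex_def bc_i_def bc_j_def bc_k_def

lemma bicomplex_multiplication_table:
  "bc_i * bc_i = -1" "bc_j * bc_j = -1" "bc_k * bc_k = 1"
  "bc_i * bc_j = bc_k" "bc_j * bc_i = bc_k"
  "bc_i * bc_k = - bc_j" "bc_k * bc_i = - bc_j"
  "bc_j * bc_k = - bc_i" "bc_k * bc_j = - bc_i"
  by (simp_all add: bicomplex_defs)

lemma bicomplex_basis:
  "\<exists>!c. x = (case c of (c0, c1, c2, c3) \<Rightarrow>
     c0 *\<^sub>R 1 + c1 *\<^sub>R bc_i + c2 *\<^sub>R bc_j + c3 *\<^sub>R bc_k)"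
  by (rule ex1I[of _ "(Re (bc_fst x), Im (bc_fst x), Re (bc_snd x), Im (bc_snd x))"])
    (cases x, auto simp: bicomplex_defs complex_eq_iff)

lemma Bicomplex_eq: "Bicomplex z1 z2 = of_complex z1 + of_complex z2 * bc_j"
  by (simp add: bicomplex_defs)

lemma of_complex_eq: "of_complex z = Re z *\<^sub>R 1 + Im z *\<^sub>R bc_i"
  by (simp add: bicomplex_defs complex_eq_iff)

lemma of_complex_hom:
  "of_complex 0 = 0" "of_complex 1 = 1"
  "of_complex (x + y) = of_complex x + of_complex y"
  "of_complex (x * y) = of_complex x * of_complex y"
  by (simp_all add: bicomplex_defs)

fun horadam :: "int \<Rightarrow> int \<Rightarrow> int \<Rightarrow> int \<Rightarrow> nat \<Rightarrow> int" where
  "horadam a b p q 0 = a"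
| "horadam a b p q (Suc 0) = b"
| "horadam a b p q (Suc (Suc n)) = p * horadam a b p q (Suc n) + q * horadam a b p q n"

definition bicomplex_horadam :: "int \<Rightarrow> int \<Rightarrow> int \<Rightarrow> int \<Rightarrow> nat \<Rightarrow> bicomplex" where
  "bicomplex_horadam a b p q n =
     of_int (horadam a b p q n) + of_int (horadam a b p q (n + 1)) * bc_i
     + of_int (horadam a b p q (n + 2)) * bc_j + of_int (horadam a b p q (n + 3)) * bc_k"

text \<open>The underlined root \<open>1 + x i + x\<^sup>2 j + x\<^sup>3 k\<close>; for non-real \<open>x\<close> the imaginary unit in \<open>x\<close>
  is the same \<open>i\<close> as the basis element, since \<open>bc_i = of_complex \<i>\<close>.\<close>

definition bc_underline :: "complex \<Rightarrow> bicomplex" where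
  "bc_underline x =
     1 + of_complex x * bc_i + of_complex x ^ 2 * bc_j + of_complex x ^ 3 * bc_k"

end

theory Submission imports Defs
begin

text \<open>By Binet's formula, \<open>s w\<^sub>n = A \<alpha>\<^sup>n - B \<beta>\<^sup>n\<close> with \<open>s = \<alpha> - \<beta>\<close>, hence
  \<open>s BH\<^sub>n = X \<alpha>\<^sup>n - Y \<beta>\<^sup>n\<close> where \<open>X\<close> and \<open>Y\<close> are \<open>A\<close> and \<open>B\<close> times the underlined roots.
  Expanding \<open>s\<^sup>2 (BH\<^sub>n\<^sup>2 - BH\<^sub>n\<^sub>+\<^sub>r BH\<^sub>n\<^sub>-\<^sub>r)\<close>, only the mixed terms in \<open>X Y\<close> survive, and they form
  \<open>X Y (\<alpha>\<beta>)\<^sup>n\<^sup>-\<^sup>r (\<alpha>\<^sup>r - \<beta>\<^sup>r)\<^sup>2\<close> with \<open>\<alpha>\<beta> = -q\<close>. It remains to divide by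
  the real number \<open>s\<^sup>2 = p\<^sup>2 + 4q\<close>.\<close>

lemma of_complex_diff: "of_complex (x - y) = of_complex x - of_complex y"
  by (simp add: bicomplex_defs)

lemma of_complex_of_nat: "of_complex (of_nat n) = of_nat n"
  by (induction n) (simp_all add: of_complex_hom)

lemma of_complex_of_int: "of_complex (of_int m) = of_int m"
  by (cases m rule: int_diff_cases) (simp add: of_complex_diff of_complex_of_nat)

text \<open>Both power sequences satisfy the recurrence, since x^(n+2) = (x + y) x^(n+1) - x y x^n
  and likewise for y. Keeping the factor x - y on the left avoids division, so the identity can be
  used directly in \<open>bicomplex\<close>.\<close>

lemma horadam_binet:
  fixes x y :: "'a::comm_ring_1"
  assumes "x + y = of_int p" and "x * y = of_int (- q)"
  shows "(x - y) * of_int (horadam a b p q n)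
    = (of_int b - of_int a * y) * x ^ n - (of_int b - of_int a * x) * y ^ n"
using assms
proof (induction a b p q n rule: horadam.induct)
  case (3 a b p q n)
  let ?A = "of_int b - of_int a * y" and ?B = "of_int b - of_int a * x"
  have q: "of_int q = - (x * y)"
    using 3(4) by simp
  have "(x - y) * of_int (horadam a b p q (Suc (Suc n)))
      = of_int p * ((x - y) * of_int (horadam a b p q (Suc n)))
        + of_int q * ((x - y) * of_int (horadam a b p q n))"
    by (simp add: algebra_simps)
  also have "\<dots> = (x + y) * (?A * x ^ Suc n - ?B * y ^ Suc n)
      + - (x * y) * (?A * x ^ n - ?B * y ^ n)"
    unfolding 3(1)[OF 3(3,4)] 3(2)[OF 3(3,4)] q 3(3)[symmetric] ..
  also have "\<dots> = ?A * x ^ Suc (Suc n) - ?B * y ^ Suc (Suc n)"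
    by (simp add: algebra_simps)
  finally show ?case .
qed (simp_all add: algebra_simps)

text \<open>Shifting the index by 1, 2 or 3 multiplies the power of each root by that root once,
  twice or three times; these factors collect into \<open>bc_underline\<close>.\<close>

lemma bicomplex_horadam_binet:
  fixes \<alpha> \<beta> :: complex
  assumes "\<alpha> + \<beta> = of_int p" and "\<alpha> * \<beta> = of_int (- q)"
  shows "of_complex (\<alpha> - \<beta>) * bicomplex_horadam a b p q n
    = of_complex (of_int b - of_int a * \<beta>) * bc_underline \<alpha> * of_complex \<alpha> ^ n
      - of_complex (of_int b - of_int a * \<alpha>) * bc_underline \<beta> * of_complex \<beta> ^ n"
proof -
  have *: "of_complex (\<alpha> - \<beta>) * of_int (horadam a b p q m)
    = of_complex (of_int b - of_int a * \<beta>) * of_complex \<alpha> ^ m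
      - of_complex (of_int b - of_int a * \<alpha>) * of_complex \<beta> ^ m" for m
  proof -
    have "of_complex \<alpha> + of_complex \<beta> = of_int p"
      and "of_complex \<alpha> * of_complex \<beta> = of_int (- q)"
      by (metis assms of_complex_hom(3,4) of_complex_of_int)+
    from horadam_binet[OF this] show ?thesis
      by (simp add: of_complex_diff of_complex_of_int of_complex_hom)
  qed
  show ?thesis
    unfolding bicomplex_horadam_def bc_underline_def
    by (simp only: distrib_left mult.assoc[symmetric] * power_add)
      (simp add: algebra_simps power2_eq_square power3_eq_cube)
qed

lemma catalan_expansion:
  fixes X Y x y :: "'a::comm_ring_1"
  assumes "r \<le> n"
  shows "(X * x ^ n - Y * y ^ n)\<^sup>2
      - (X * x ^ (n + r) - Y * y ^ (n + r)) * (X * x ^ (n - r) - Y * y ^ (n - r))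
    = X * Y * (x * y) ^ (n - r) * (x ^ r - y ^ r)\<^sup>2"
proof -
  \<comment> \<open>Writing n - r as m removes the truncated subtraction, leaving a polynomial
    identity in the m-th and r-th powers of x and y.\<close>
  obtain m where "n = m + r"
    using assms by (metis le_add_diff_inverse2)
  then show ?thesis
    by (simp add: power_add power_mult_distrib power2_eq_square algebra_simps)
qed

theorem theorem3p3:
  fixes a b p q :: int and s \<alpha> \<beta> A B :: complex and n r :: nat
  assumes "p\<^sup>2 + 4 * q \<noteq> 0"
    and "s\<^sup>2 = of_int (p\<^sup>2 + 4 * q)"
    and "\<alpha> = (of_int p + s) / 2"
    and "\<beta> = (of_int p - s) / 2"
    and "A = of_int b - of_int a * \<beta>"
    and "B = of_int b - of_int a * \<alpha>"
    and "r \<le> n"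
  shows "(bicomplex_horadam a b p q n)\<^sup>2
           - bicomplex_horadam a b p q (n + r) * bicomplex_horadam a b p q (n - r)
         = ((of_complex A * of_complex B * bc_underline \<alpha> * bc_underline \<beta> * of_int (- q) ^ (n - r))
              /\<^sub>R real_of_int (p\<^sup>2 + 4 * q))
           * (of_complex \<alpha> ^ r - of_complex \<beta> ^ r)\<^sup>2"
proof -
  let ?H = "bicomplex_horadam a b p q" and ?d = "real_of_int (p\<^sup>2 + 4 * q)"
  let ?X = "of_complex A * bc_underline \<alpha>" and ?Y = "of_complex B * bc_underline \<beta>"
  have sum: "\<alpha> + \<beta> = of_int p" and diff: "\<alpha> - \<beta> = s"
    unfolding assms(3,4) by (simp_all add: add_divide_distrib diff_divide_distrib)
  have "4 * (\<alpha> * \<beta>) = (of_int p)\<^sup>2 - s\<^sup>2"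
    unfolding assms(3,4) by (simp add: field_simps power2_eq_square)
  then have prod: "\<alpha> * \<beta> = of_int (- q)"
    using assms(2) by simp
  then have prod': "of_complex \<alpha> * of_complex \<beta> = of_int (- q)"
    by (metis of_complex_hom(4) of_complex_of_int)
  have binet: "of_complex s * ?H m = ?X * of_complex \<alpha> ^ m - ?Y * of_complex \<beta> ^ m" for m
    using bicomplex_horadam_binet[OF sum prod, of a b m] assms(5,6) diff by simp
  \<comment> \<open>Even for non-real \<open>s\<close> the square is an integer, so multiplying by
    it is scaling by the real number \<open>?d\<close>.\<close>
  have "of_complex s * of_complex s = of_int (p\<^sup>2 + 4 * q)"
    by (metis assms(2) of_complex_hom(4) of_complex_of_int power2_eq_square)
  then have "?d *\<^sub>R ((?H n)\<^sup>2 - ?H (n + r) * ?H (n - r))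
      = of_complex s * of_complex s * ((?H n)\<^sup>2 - ?H (n + r) * ?H (n - r))"
    by (simp only: scaleR_conv_of_real of_real_of_int_eq)
  also have "\<dots> = (of_complex s * ?H n)\<^sup>2 - (of_complex s * ?H (n + r)) * (of_complex s * ?H (n - r))"
    by (simp add: algebra_simps power2_eq_square)
  also have "\<dots> = ?X * ?Y * of_int (- q) ^ (n - r) * (of_complex \<alpha> ^ r - of_complex \<beta> ^ r)\<^sup>2"
    unfolding binet catalan_expansion[OF assms(7)] prod' ..
  finally have eq: "?d *\<^sub>R ((?H n)\<^sup>2 - ?H (n + r) * ?H (n - r))
      = ?X * ?Y * of_int (- q) ^ (n - r) * (of_complex \<alpha> ^ r - of_complex \<beta> ^ r)\<^sup>2" .
  have nonzero: "?d \<noteq> 0"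
    using assms(1) by (simp only: of_int_eq_0_iff not_False_eq_True)
  \<comment> \<open>The bicomplex numbers have zero divisors, so the factor is cancelled as a
    nonzero real scalar.\<close>
  have "(?H n)\<^sup>2 - ?H (n + r) * ?H (n - r)
      = (?d *\<^sub>R ((?H n)\<^sup>2 - ?H (n + r) * ?H (n - r))) /\<^sub>R ?d"
    by (simp only: scaleR_scaleR left_inverse[OF nonzero] scaleR_one)
  also have "\<dots> = ((of_complex A * of_complex B * bc_underline \<alpha> * bc_underline \<beta> * of_int (- q) ^ (n - r))
        /\<^sub>R ?d) * (of_complex \<alpha> ^ r - of_complex \<beta> ^ r)\<^sup>2"
    unfolding eq mult_scaleR_left by (simp only: mult_ac)
  finally show ?thesis .
qed

end
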